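(* Let $n\geq 2$ be a positive integer, let $\mathbb{F}$ be a field with $\mathrm{char}(\mathbb{F})=0$, and let $f\colon \mathbb{F}\to \mathbb{C}$ be a quadratic function. Then \[ f(x^{n})= f(x)^{n} \] holds for each $x\in \mathbb{F}$ if and only if there exist homomorphisms $\varphi_{1}, \varphi_{2}\colon \mathbb{F}\to \mathbb{C}$ such that \[ f(x)= f(1)\cdot \varphi_{1}(x)\varphi_{2}(x) \qquad (x\in \mathbb{F}), \] and furthermore either $f(1)=0$ and then $f$ is identically zero, or $f(1)$ is an $(n-1)$st root of unity.
   Context: A function $f\colon \mathbb{F}\to\mathbb{C}$ is quadratic (a generalized monomial of degree $2$) if there is a symmetric bi-additive function $F\colon \mathbb{F}^2\to\mathbb{C}$ (additive in each variable) with $f(x)=F(x,x)$ for all $x\in\mathbb{F}$. A homomorphism $\varphi\colon\mathbb{F}\to\mathbb{C}$ is a map with $\varphi(a+b)=\varphi(a)+\varphi(b)$ and $\varphi(ab)=\varphi(a)\varphi(b)$ for all $a,b\in\mathbb{F}$; it is not required that $\varphi(1)=1$, so the identically zero map is allowed. *)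

theory Defs
  imports Complex_Main
begin

definition symmetric_biadditive :: "('a::ab_group_add \<Rightarrow> 'a \<Rightarrow> complex) \<Rightarrow> bool" where
  "symmetric_biadditive F \<longleftrightarrow>
     (\<forall>x y. F x y = F y x) \<and>
     (\<forall>y. additive (\<lambda>x. F x y)) \<and>
     (\<forall>x. additive (\<lambda>y. F x y))"

definition quadratic :: "('a::ab_group_add \<Rightarrow> complex) \<Rightarrow> bool" where
  "quadratic f \<longleftrightarrow> (\<exists>F. symmetric_biadditive F \<and> (\<forall>x. f x = F x x))"

(* Not required to preserve 1, so the zero map is a homomorphism. *)
definition homomorphism :: "('a::field \<Rightarrow> complex) \<Rightarrow> bool" where
  "homomorphism \<phi> \<longleftrightarrow> additive \<phi> \<and> (\<forall>a b. \<phi> (a * b) = \<phi> a * \<phi> b)"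

end

theory Submission
  imports Defs "HOL-Computational_Algebra.Polynomial"
begin

text \<open>
  Let \<open>f x = F x x\<close> and \<open>a x = F 1 x\<close>. Both sides of \<open>f ((1 + r x)^n) = f (1 + r x)^n\<close> are
  polynomials in the natural number \<open>r\<close>, so their coefficients agree. If \<open>f 1 = 0\<close>, degrees \<open>1\<close>
  and \<open>2\<close> give \<open>f = 0\<close>. If \<open>f 1 = 1\<close> (the general case is a rescaling), degree \<open>2\<close> gives
  \<open>f x = 2 (a x)\<^sup>2 - a (x\<^sup>2)\<close>, and degree \<open>3\<close> then gives
  \<open>a (x ^ 3) = 3 a x * a (x\<^sup>2) - 2 (a x)^3\<close>. The latter is the identity satisfied by half the
  trace of a \<open>2 \<times> 2\<close> matrix: it forces \<open>a (x y) - a x * a y = \<delta> x * \<delta> y\<close> for an additive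
  \<open>\<delta>\<close>, so that \<open>a + \<delta>\<close> and \<open>a - \<delta>\<close> are multiplicative, with product \<open>f\<close>.
\<close>

section \<open>Comparison of coefficients along \<open>1 + r * x\<close>\<close>

lemma additive_of_nat_mult:
  fixes g :: "'a::ring_1 \<Rightarrow> 'b::ring_1"
  assumes "additive g"
  shows "g (of_nat k * x) = of_nat k * g x"
  by (induction k) (simp_all add: additive.zero[OF assms] additive.add[OF assms] algebra_simps)

lemma poly_eqI_of_nat:
  fixes p q :: "'a::{idom, ring_char_0} poly"
  assumes "\<And>r. poly p (of_nat r) = poly q (of_nat r)"
  shows "p = q"
proof (rule ccontr)
  assume "p \<noteq> q"
  then have "finite {x. poly (p - q) x = 0}"
    by (intro poly_roots_finite) simp
  moreover have "range of_nat \<subseteq> {x. poly (p - q) x = 0}"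
    using assms by auto
  ultimately have "finite (range (of_nat :: nat \<Rightarrow> 'a))"
    by (rule finite_subset[rotated])
  then show False
    using inj_of_nat by (simp add: finite_image_iff)
qed

lemma symmetric_biadditiveD:
  assumes "symmetric_biadditive F"
  shows "F x y = F y x" "additive (\<lambda>x. F x y)" "additive (F x)"
  using assms by (simp_all add: symmetric_biadditive_def)

text \<open>\<open>F\<close> is merely additive in each variable, so scalars can be pulled out only
  when they are natural numbers. Substituting \<open>1 + of_nat r * x\<close> into
  \<open>pow\<close> gives two complex polynomials that agree at every natural number, hence
  everywhere. The left side is the degree \<open>m\<close> part of the double binomial
  expansion.\<close>

lemma quadratic_power_coeffs:
  fixes F :: "'a::comm_ring_1 \<Rightarrow> 'a \<Rightarrow> complex"
  assumes F: "symmetric_biadditive F"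
    and pow: "\<And>x. F (x ^ n) (x ^ n) = F x x ^ n"
  shows "(\<Sum>j\<le>m. of_nat (n choose j) * of_nat (n choose (m - j)) * F (x ^ j) (x ^ (m - j)))
    = coeff ([:F 1 1, 2 * F 1 x, F x x:] ^ n) m"
proof -
  note F' = symmetric_biadditiveD[OF F]
  define c where "c j k = of_nat (n choose j) * of_nat (n choose k) * F (x ^ j) (x ^ k)" for j k
  define P where "P = (\<Sum>j\<le>n. \<Sum>k\<le>n. monom (c j k) (j + k))"
  have "poly P (of_nat r) = poly ([:F 1 1, 2 * F 1 x, F x x:] ^ n) (of_nat r)" for r
  proof -
    have "(1 + of_nat r * x) ^ n = (\<Sum>k\<le>n. of_nat ((n choose k) * r ^ k) * x ^ k)"
      using binomial_ring[of "of_nat r * x" 1 n] by (simp add: power_mult_distrib algebra_simps)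
    then have "F ((1 + of_nat r * x) ^ n) ((1 + of_nat r * x) ^ n)
      = (\<Sum>j\<le>n. \<Sum>k\<le>n. F (of_nat ((n choose j) * r ^ j) * x ^ j) (of_nat ((n choose k) * r ^ k) * x ^ k))"
      by (simp add: additive.sum[OF F'(2)] additive.sum[OF F'(3)]) (rule sum.swap)
    also have "\<dots> = poly P (of_nat r)"
      unfolding P_def poly_sum poly_monom c_def
      by (intro sum.cong refl)
        (simp only: additive_of_nat_mult[OF F'(2)] additive_of_nat_mult[OF F'(3)],
          simp add: power_add)
    finally have "poly P (of_nat r) = F (1 + of_nat r * x) (1 + of_nat r * x) ^ n"
      using pow by simp
    also have "F (1 + of_nat r * x) (1 + of_nat r * x)
        = poly [:F 1 1, 2 * F 1 x, F x x:] (of_nat r)"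
      using F'(1)[of 1 x]
      by (simp only: additive.add[OF F'(2)] additive.add[OF F'(3)]
          additive_of_nat_mult[OF F'(2)] additive_of_nat_mult[OF F'(3)])
        (simp add: algebra_simps)
    finally show ?thesis
      by (simp add: poly_power)
  qed
  then have "P = [:F 1 1, 2 * F 1 x, F x x:] ^ n"
    by (rule poly_eqI_of_nat)
  moreover have "coeff P m = (\<Sum>j\<le>m. c j (m - j))"
  proof -
    have "coeff P m = (\<Sum>j\<le>n. \<Sum>k\<le>n. if j + k = m then c j k else 0)"
      by (simp add: P_def coeff_sum)
    also have "\<dots> = (\<Sum>j\<le>n. if j \<le> m then c j (m - j) else 0)"
    proof (intro sum.cong refl)
      fix j
      have "(\<Sum>k\<le>n. if j + k = m then c j k else 0)
          = (\<Sum>k\<le>n. if k = m - j then (if j \<le> m then c j k else 0) else 0)"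
        by (intro sum.cong refl) auto
      also have "\<dots> = (if m - j \<le> n \<and> j \<le> m then c j (m - j) else 0)"
        by simp
      \<comment> \<open>The range condition may be dropped: \<open>n choose (m - j)\<close> vanishes
        when \<open>m - j\<close> exceeds \<open>n\<close>. The same vanishing later extends the
        range of \<open>j\<close> to \<open>m\<close>.\<close>
      also have "\<dots> = (if j \<le> m then c j (m - j) else 0)"
        by (auto simp: c_def)
      finally show "(\<Sum>k\<le>n. if j + k = m then c j k else 0) = \<dots>" .
    qed
    also have "\<dots> = (\<Sum>j\<in>{..n} \<inter> {..m}. c j (m - j))"
      by (subst sum.inter_restrict) (simp_all add: atMost_def)
    also have "\<dots> = (\<Sum>j\<le>m. c j (m - j))"
      by (rule sum.mono_neutral_left) (auto simp: c_def)
    finally show ?thesis .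
  qed
  ultimately show ?thesis
    by (simp add: c_def)
qed

section \<open>Coefficients of low degree and the identities they yield\<close>

lemma of_nat_choose_two: "(of_nat (n choose 2) :: 'a::field_char_0) = of_nat n * (of_nat n - 1) / 2"
  by (induction n) (simp_all add: numeral_2_eq_2 field_simps)

lemma of_nat_choose_three:
  "(of_nat (n choose 3) :: 'a::field_char_0) = of_nat n * (of_nat n - 1) * (of_nat n - 2) / 6"
proof (induction n)
  case (Suc n)
  have "Suc n choose 3 = (n choose 2) + (n choose 3)"
    by (simp add: numeral_3_eq_3 numeral_2_eq_2)
  then show ?case
    by (simp add: Suc of_nat_choose_two field_simps)
qed simp

lemma coeff_trinomial_power:
  fixes b d :: "'a::field_char_0"
  shows "coeff ([:1, b, d:] ^ n) 0 = 1"
    and "coeff ([:1, b, d:] ^ n) 1 = of_nat n * b"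
    and "coeff ([:1, b, d:] ^ n) 2 = of_nat n * d + of_nat n * (of_nat n - 1) / 2 * b\<^sup>2"
    and "coeff ([:1, b, d:] ^ n) 3
      = of_nat n * (of_nat n - 1) * b * d + of_nat n * (of_nat n - 1) * (of_nat n - 2) / 6 * b ^ 3"
proof -
  let ?p = "\<lambda>n. [:1, b, d:] ^ n"
  \<comment> \<open>Multiplication by one more trinomial factor; the value 0 in the case distinction
    stands for the coefficient of index -1.\<close>
  have s: "coeff (?p (Suc n)) (Suc k)
      = coeff (?p n) (Suc k) + b * coeff (?p n) k + d * (case k of 0 \<Rightarrow> 0 | Suc i \<Rightarrow> coeff (?p n) i)"
    for n k
    by (cases k) (simp_all add: coeff_pCons algebra_simps)
  show 0: "coeff (?p n) 0 = 1" for n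
    by (simp add: coeff_0_power)
  show 1: "coeff (?p n) 1 = of_nat n * b" for n
    by (induction n) (simp_all add: s 0 algebra_simps del: power_Suc)
  show 2: "coeff (?p n) 2 = of_nat n * d + of_nat n * (of_nat n - 1) / 2 * b\<^sup>2" for n
  proof (induction n)
    case (Suc n)
    show ?case
      using s[of n 1] Suc 0[of n] 1[of n]
      by (simp add: numeral_2_eq_2 field_simps del: power_Suc) (simp add: algebra_simps)
  qed simp
  show "coeff (?p n) 3
      = of_nat n * (of_nat n - 1) * b * d + of_nat n * (of_nat n - 1) * (of_nat n - 2) / 6 * b ^ 3"
  proof (induction n)
    case (Suc n)
    have step: "coeff (?p (Suc n)) 3 = coeff (?p n) 3 + b * coeff (?p n) 2 + d * coeff (?p n) 1"
      using s[of n 2] by (simp add: numeral_3_eq_3 numeral_2_eq_2 del: power_Suc)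
    show ?case
      unfolding step Suc 1 2 by (simp add: field_simps power2_eq_square power3_eq_cube)
  qed simp
qed

text \<open>Without constant term the trinomial is divisible by the indeterminate, so its power
  starts in degree \<open>n\<close>, which exceeds 1; degree 1 then gives \<open>F 1 x = 0\<close>.
  What remains is a monomial whose power has degree \<open>2 * n\<close>, which exceeds 2, so degree
  2 gives \<open>F x x = 0\<close>.\<close>

lemma quadratic_power_vanishing:
  fixes F :: "'a::comm_ring_1 \<Rightarrow> 'a \<Rightarrow> complex"
  assumes F: "symmetric_biadditive F"
    and pow: "\<And>x. F (x ^ n) (x ^ n) = F x x ^ n"
    and n: "n \<ge> 2" and zero: "F 1 1 = 0"
  shows "F x x = 0"
proof -
  note coeffs = quadratic_power_coeffs[where F = F, OF F pow]
  have lin: "F 1 x = 0" for x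
  proof -
    have "[:0, 2 * F 1 x, F x x:] ^ n = monom 1 n * [:2 * F 1 x, F x x:] ^ n"
      by (simp flip: power_mult_distrib monom_power[of 1 1 n, simplified] add: monom_altdef)
    then have "coeff ([:F 1 1, 2 * F 1 x, F x x:] ^ n) 1 = 0"
      using n zero by (simp add: coeff_monom_mult)
    with coeffs[of 1 x] n symmetric_biadditiveD(1)[OF F, of 1 x] show ?thesis
      by simp
  qed
  have "[:0, 0, F x x:] = monom (F x x) 2"
    by (simp add: monom_altdef numeral_2_eq_2)
  then have "coeff ([:F 1 1, 2 * F 1 x, F x x:] ^ n) 2 = 0"
    using n zero lin[of x] by (simp add: monom_power)
  with coeffs[of 2 x] n lin[of "x\<^sup>2"] symmetric_biadditiveD(1)[OF F, of 1 "x\<^sup>2"] show ?thesis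
    by (simp add: numeral_2_eq_2)
qed

lemma quadratic_power_identities:
  fixes F :: "'a::comm_ring_1 \<Rightarrow> 'a \<Rightarrow> complex"
  assumes F: "symmetric_biadditive F"
    and pow: "\<And>x. F (x ^ n) (x ^ n) = F x x ^ n"
    and n: "n \<ge> 2" and one: "F 1 1 = 1"
  shows "F x x = 2 * (F 1 x)\<^sup>2 - F 1 (x\<^sup>2)"
    and "F 1 (x ^ 3) = 3 * F 1 x * F 1 (x\<^sup>2) - 2 * F 1 x ^ 3"
proof -
  note F' = symmetric_biadditiveD[OF F]
  note coeffs = quadratic_power_coeffs[where F = F, OF F pow]
  have sum_atMost_2: "sum g {..2} = g 0 + g 1 + g 2" for g :: "nat \<Rightarrow> complex"
    by (simp add: numeral_2_eq_2)
  have sum_atMost_3: "sum g {..3} = g 0 + g 1 + g 2 + g 3" for g :: "nat \<Rightarrow> complex"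
    by (simp add: numeral_2_eq_2 numeral_3_eq_3)
  define N :: complex where "N = of_nat n"
  have "N + 1 = of_nat (Suc n)"
    by (simp add: N_def)
  then have N: "N \<noteq> 0" "N - 1 \<noteq> 0" "N + 1 \<noteq> 0"
    using n by (auto simp: N_def simp del: of_nat_Suc)
  show diag: "F x x = 2 * (F 1 x)\<^sup>2 - F 1 (x\<^sup>2)" for x
  proof -
    have "N * (N - 1) * F 1 (x\<^sup>2) + N * N * F x x
        = N * F x x + N * (N - 1) / 2 * (2 * F 1 x)\<^sup>2" (is "?l = ?r")
      using coeffs[of 2 x] F'(1)[of "x\<^sup>2" 1] one
      by (simp add: sum_atMost_2 coeff_trinomial_power of_nat_choose_two N_def mult.assoc)
    moreover have "N * (N - 1) * (F x x - (2 * (F 1 x)\<^sup>2 - F 1 (x\<^sup>2))) = ?l - ?r"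
      by (simp add: field_simps power2_eq_square)
    ultimately have "N * (N - 1) * (F x x - (2 * (F 1 x)\<^sup>2 - F 1 (x\<^sup>2))) = 0"
      by simp
    with N show ?thesis by simp
  qed
  have polar: "F x y = 2 * F 1 x * F 1 y - F 1 (x * y)" for x y
  proof -
    have "F (x + y) (x + y) = F x x + 2 * F x y + F y y"
      using F'(1)[of y x] by (simp add: additive.add[OF F'(2)] additive.add[OF F'(3)])
    moreover have "F 1 ((x + y)\<^sup>2) = F 1 (x\<^sup>2) + 2 * F 1 (x * y) + F 1 (y\<^sup>2)"
      by (simp only: power2_eq_square distrib_left distrib_right additive.add[OF F'(3)]
          mult.commute[of y x]) simp
    ultimately have "2 * F x y = 2 * (2 * F 1 x * F 1 y - F 1 (x * y))"
      unfolding diag by (simp add: additive.add[OF F'(3)] power2_eq_square algebra_simps)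
    then show ?thesis
      by (simp only: mult_cancel_left zero_neq_numeral[symmetric] simp_thms)
  qed
  have "N * (N - 1) * (N - 2) / 3 * F 1 (x ^ 3) + N * N * (N - 1) * F x (x\<^sup>2)
      = N * (N - 1) * (2 * F 1 x) * F x x + N * (N - 1) * (N - 2) / 6 * (2 * F 1 x) ^ 3"
    (is "?l = ?r")
    using coeffs[of 3 x] F'(1)[of "x ^ 3" 1] F'(1)[of "x\<^sup>2" x]
      one
    by (simp add: sum_atMost_3 coeff_trinomial_power of_nat_choose_two of_nat_choose_three N_def mult.assoc)
  \<comment> \<open>Eliminating \<open>F x (x\<^sup>2)\<close> by \<open>polar\<close> leaves the
    coefficient \<open>(N - 2) / 3 - N = - 2 / 3 * (N + 1)\<close> on \<open>F 1 (x ^ 3)\<close>, up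
    to the common factor \<open>N * (N - 1)\<close>.\<close>
  moreover have "N * (N - 1) * (N + 1) * (F 1 (x ^ 3) - (3 * F 1 x * F 1 (x\<^sup>2) - 2 * F 1 x ^ 3))
      = 3 / 2 * (?r - ?l)"
    unfolding polar[of x "x\<^sup>2"] diag[of x]
    by (simp add: field_simps power2_eq_square power3_eq_cube)
  ultimately have
    "N * (N - 1) * (N + 1) * (F 1 (x ^ 3) - (3 * F 1 x * F 1 (x\<^sup>2) - 2 * F 1 x ^ 3)) = 0"
    by simp
  with N show "F 1 (x ^ 3) = 3 * F 1 x * F 1 (x\<^sup>2) - 2 * F 1 x ^ 3"
    by simp
qed

section \<open>Splitting the cubic functional equation into two homomorphisms\<close>

lemma additive_cubic_polarization:
  fixes a :: "'a::comm_ring_1 \<Rightarrow> complex"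
  assumes a: "additive a"
    and cubic: "\<And>x. a (x ^ 3) = 3 * a x * a (x\<^sup>2) - 2 * a x ^ 3"
  shows "a (x * y * z) = a x * a (y * z) + a y * a (x * z) + a z * a (x * y) - 2 * a x * a y * a z"
proof -
  define E where "E x = a (x ^ 3) - 3 * a x * a (x\<^sup>2) + 2 * a x ^ 3" for x
  \<comment> \<open>\<open>E\<close> is a cubic form, and inclusion-exclusion extracts 6 times its
    symmetric trilinear form.\<close>
  have "E (x + y + z) - E (x + y) - E (y + z) - E (x + z) + E x + E y + E z
    = 6 * (a (x * y * z)
        - (a x * a (y * z) + a y * a (x * z) + a z * a (x * y) - 2 * a x * a y * a z))"
    (is "_ = 6 * (?l - ?r)")
    by (simp only: E_def power2_eq_square power3_eq_cube distrib_left distrib_right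
        additive.add[OF a] mult.assoc mult.commute mult.left_commute) (simp add: algebra_simps)
  moreover have "E x = 0" for x
    by (simp add: E_def cubic)
  ultimately have "6 * (?l - ?r) = 0"
    by simp
  then show ?thesis
    by (simp only: mult_eq_0_iff zero_neq_numeral[symmetric] simp_thms eq_iff_diff_eq_0[symmetric])
qed

text \<open>If \<open>a\<close> is half the sum of two homomorphisms, then its multiplicative defect
  \<open>B x y\<close> is \<open>\<delta> x * \<delta> y\<close> with \<delta> half their
  difference. So it suffices to factor \<open>B\<close> in this way.\<close>

lemma additive_cubic_splits:
  fixes a :: "'a::field \<Rightarrow> complex"
  assumes a: "additive a"
    and cubic: "\<And>x. a (x ^ 3) = 3 * a x * a (x\<^sup>2) - 2 * a x ^ 3"
  obtains \<phi> \<psi> where "homomorphism \<phi>" "homomorphism \<psi>"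
    "\<And>x. \<phi> x * \<psi> x = 2 * (a x)\<^sup>2 - a (x\<^sup>2)"
proof -
  define B where "B x y = a (x * y) - a x * a y" for x y
  have B_sym: "B x y = B y x" for x y
    by (simp add: B_def mult.commute)
  have B_add: "B x (y + z) = B x y + B x z" for x y z
    by (simp add: B_def additive.add[OF a] algebra_simps)
  have B_deriv: "B x (y * z) = a y * B x z + a z * B x y" for x y z
    using additive_cubic_polarization[OF a cubic, of x y z]
    by (simp add: B_def algebra_simps)
  \<comment> \<open>Expanding \<open>B x (y * z * w)\<close> in two ways.\<close>
  have B_exchange: "B z w * B x y = B y z * B x w" for x y z w
  proof -
    have "B x (y * (z * w)) = B x (y * z * w)"
      by (simp add: mult.assoc)
    then show ?thesis
      unfolding B_deriv by (simp add: B_def algebra_simps)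
  qed
  \<comment> \<open>By \<open>B_exchange\<close> the symmetric form \<open>B\<close> has rank at
    most one, so over the complex numbers it is the square of an additive map. Normalizing
    \<open>B u\<close> by a square root of \<open>B u u\<close> gives this map.\<close>
  obtain \<delta> where \<delta>_add: "additive \<delta>" and \<delta>: "\<And>x y. B x y = \<delta> x * \<delta> y"
    and \<delta>_deriv: "\<And>x y. \<delta> (x * y) = a x * \<delta> y + a y * \<delta> x"
  proof (cases "\<exists>u. B u u \<noteq> 0")
    case True
    then obtain u where u: "B u u \<noteq> 0" ..
    define s where "s = csqrt (B u u)"
    have s: "s * s = B u u" "s \<noteq> 0"
      using u by (auto simp: s_def simp flip: power2_eq_square)
    show ?thesis
    proof (rule that[of "\<lambda>x. B u x / s"])
      show "additive (\<lambda>x. B u x / s)"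
        by unfold_locales (simp add: B_add add_divide_distrib)
      show "B x y = B u x / s * (B u y / s)" for x y
        using B_exchange[of x y u u] s u by (simp add: field_simps)
      show "B u (x * y) / s = a x * (B u y / s) + a y * (B u x / s)" for x y
        by (simp add: B_deriv add_divide_distrib)
    qed
  next
    case False
    \<comment> \<open>Here \<open>B_exchange\<close> reads
      \<open>B x y * B y x = B x x * B y y\<close>, so a zero diagonal forces \<open>B\<close> to
      vanish.\<close>
    then have "B x y = 0" for x y
      using B_exchange[of y x x y] B_sym[of x y] by simp
    then show ?thesis
      by (intro that[of "\<lambda>_. 0"]) (auto simp: additive_def)
  qed
  have a_mult: "a (x * y) = a x * a y + \<delta> x * \<delta> y" for x y
    using \<delta>[of x y] by (simp add: B_def algebra_simps)
  show ?thesis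
  proof (rule that[of "\<lambda>x. a x + \<delta> x" "\<lambda>x. a x - \<delta> x"])
    show "homomorphism (\<lambda>x. a x + \<delta> x)" "homomorphism (\<lambda>x. a x - \<delta> x)"
      by (simp_all add: homomorphism_def additive_def additive.add[OF a] additive.add[OF \<delta>_add]
          a_mult \<delta>_deriv algebra_simps)
    show "(a x + \<delta> x) * (a x - \<delta> x) = 2 * (a x)\<^sup>2 - a (x\<^sup>2)" for x
      by (simp add: power2_eq_square a_mult algebra_simps)
  qed
qed

section \<open>Powers of homomorphisms and the equivalence\<close>

lemma homomorphism_power:
  assumes "homomorphism \<phi>" and "n > 0"
  shows "\<phi> (x ^ n) = \<phi> x ^ n"
  using assms(2)
  \<comment> \<open>The induction starts at 1 because \<open>\<phi> 1\<close> may be 0.\<close>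
  by (induction n rule: nat_induct_non_zero) (use assms(1) in \<open>simp_all add: homomorphism_def\<close>)

theorem corollary2:
  fixes f :: "'a::field_char_0 \<Rightarrow> complex" and n :: nat
  assumes "n \<ge> 2" and "quadratic f"
  shows "(\<forall>x. f (x ^ n) = f x ^ n) \<longleftrightarrow>
    (\<exists>\<phi>\<^sub>1 \<phi>\<^sub>2. homomorphism \<phi>\<^sub>1 \<and> homomorphism \<phi>\<^sub>2 \<and>
       (\<forall>x. f x = f 1 * (\<phi>\<^sub>1 x * \<phi>\<^sub>2 x))) \<and>
    (f 1 = 0 \<and> (\<forall>x. f x = 0) \<or> f 1 ^ (n - 1) = 1)"
    (is "?pow \<longleftrightarrow> ?split \<and> ?root")
proof
  assume pow: ?pow
  obtain F where F: "symmetric_biadditive F" and f: "\<And>x. f x = F x x"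
    using assms(2) by (auto simp: quadratic_def)
  have F_pow: "F (x ^ n) (x ^ n) = F x x ^ n" for x
    using pow by (simp flip: f)
  show "?split \<and> ?root"
  proof (cases "f 1 = 0")
    case True
    have "f x = 0" for x
      using quadratic_power_vanishing[where F = F, OF F F_pow assms(1)] True by (simp add: f)
    moreover have "homomorphism (\<lambda>_::'a. 0)"
      by (simp add: homomorphism_def additive_def)
    ultimately show ?thesis by auto
  next
    case False
    have c: "f 1 ^ n = f 1"
      using pow by (metis power_one)
    moreover have "f 1 ^ n = f 1 * f 1 ^ (n - 1)"
      using assms(1) by (simp flip: power_Suc)
    ultimately have root: "f 1 ^ (n - 1) = 1"
      using False by (metis mult_cancel_left mult.right_neutral)
    \<comment> \<open>Since \<open>f 1 ^ n = f 1\<close>, division by \<open>f 1\<close> preserves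
      the power identity and normalizes the value at 1.\<close>
    define G where "G x y = F x y / f 1" for x y
    have G: "symmetric_biadditive G"
      using F by (simp add: symmetric_biadditive_def additive_def G_def add_divide_distrib)
    have G_pow: "G (x ^ n) (x ^ n) = G x x ^ n" for x
      by (simp add: G_def F_pow power_divide c)
    have G_one: "G 1 1 = 1"
      using False by (simp add: G_def f)
    note ids = quadratic_power_identities[where F = G, OF G G_pow assms(1) G_one]
    obtain \<phi> \<psi> where "homomorphism \<phi>" "homomorphism \<psi>"
      and prod: "\<And>x. \<phi> x * \<psi> x = 2 * (G 1 x)\<^sup>2 - G 1 (x\<^sup>2)"
      using additive_cubic_splits[OF symmetric_biadditiveD(3)[OF G] ids(2)] by blast
    moreover have "f x = f 1 * (\<phi> x * \<psi> x)" for x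
      unfolding prod ids(1)[symmetric] using False by (simp add: G_def f)
    ultimately show ?thesis
      using root by blast
  qed
next
  assume "?split \<and> ?root"
  then obtain \<phi> \<psi> where hom: "homomorphism \<phi>" "homomorphism \<psi>"
    and f: "\<And>x. f x = f 1 * (\<phi> x * \<psi> x)" and root: ?root
    by blast
  have c: "f 1 ^ n = f 1"
    using root assms(1) by (cases n) auto
  show ?pow
  proof
    fix x
    have "f (x ^ n) = f 1 ^ n * (\<phi> x ^ n * \<psi> x ^ n)"
      using assms(1) f[of "x ^ n"] c
      by (simp add: homomorphism_power[OF hom(1)] homomorphism_power[OF hom(2)])
    also have "\<dots> = f x ^ n"
      unfolding f[of x] by (simp add: power_mult_distrib)
    finally show "f (x ^ n) = f x ^ n" .
  qed
qed

end
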